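(* Let $n\ge 2$ and let $\varphi=\tau_n\cdots\tau_2\tau_1$ act on $\mathcal I_n$. Then for every $1\le j\le n$ the statistic $\chi_j-\chi_{n+1-j}$ is $0$-mesic under the action of $\varphi$ on $\mathcal I_n$; that is, for every $\varphi$-orbit $\mathcal O\subseteq\mathcal I_n$, $$\frac1{\#\mathcal O}\sum_{S\in\mathcal O}\bigl(\chi_j(S)-\chi_{n+1-j}(S)\bigr)=0.$$
   Context: $[n]=\{1,\dots,n\}$. $\mathcal I_n$ is the set of independent sets of the path graph on $[n]$, i.e. subsets $S\subseteq[n]$ containing no two consecutive integers. For $i\in[n]$ the toggle $\tau_i:\mathcal I_n\to\mathcal I_n$ is defined by: $\tau_i(S)=S\setminus\{i\}$ if $i\in S$; $\tau_i(S)=S\cup\{i\}$ if $i\notin S$ and $S\cup\{i\}\in\mathcal I_n$; and $\tau_i(S)=S$ otherwise. Products of toggles are compositions performed from right to left, so $\varphi=\tau_n\cdots\tau_2\tau_1$ applies $\tau_1$ first, then $\tau_2$, etc. $\chi_j(S)=1$ if $j\in S$ and $0$ otherwise. For an invertible map $w$ on a finite set $X$, a function $f$ on $X$ with values in a field of characteristic $0$ is $c$-mesic under $w$ if its average over every $w$-orbit equals $c$. *)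

theory Defs
  imports Complex_Main "HOL-Combinatorics.Orbits"
begin

definition indep_sets :: "nat \<Rightarrow> nat set set" where
  "indep_sets n = {S. S \<subseteq> {1..n} \<and> (\<forall>i\<in>S. Suc i \<notin> S)}"

definition toggle :: "nat \<Rightarrow> nat \<Rightarrow> nat set \<Rightarrow> nat set" where
  "toggle n i S =
     (if i \<in> S then S - {i}
      else if S \<union> {i} \<in> indep_sets n then S \<union> {i}
      else S)"

text \<open>\<open>fold\<close> applies the first list element first, so this is the composition
  \<open>toggle n n \<circ> \<dots> \<circ> toggle n 2 \<circ> toggle n 1\<close>.\<close>

definition phi :: "nat \<Rightarrow> nat set \<Rightarrow> nat set" where
  "phi n = fold (toggle n) [1..<Suc n]"

definition chi :: "nat \<Rightarrow> nat set \<Rightarrow> 'k::field_char_0" where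
  "chi j S = (if j \<in> S then 1 else 0)"

text \<open>The library's \<open>orbit w x\<close> consists of the iterates \<open>(w ^^ k) x\<close> with \<open>k \<ge> 1\<close>. The first
  two conjuncts, that \<open>w\<close> is an invertible map on the finite set \<open>X\<close>, ensure that for
  \<open>x \<in> X\<close> this is the full (finite, two-sided) orbit of \<open>x\<close>.\<close>

definition mesic :: "'k::field_char_0 \<Rightarrow> ('a \<Rightarrow> 'k) \<Rightarrow> ('a \<Rightarrow> 'a) \<Rightarrow> 'a set \<Rightarrow> bool" where
  "mesic c f w X \<longleftrightarrow>
     finite X \<and> bij_betw w X X \<and>
     (\<forall>orb \<in> orbit w ` X. 1 / of_nat (card orb) * (\<Sum>x\<in>orb. f x) = c)"

end

theory Submission
  imports Defs
begin

text \<open>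
  Regard \<open>(S, i)\<close> with \<open>i \<in> S\<close> as a cell, in column \<open>i\<close>, of the board whose rows are the iterates of
  \<open>\<phi>\<close>. Every cell left of column \<open>n\<close> has a unique successor, either \<open>(S, i + 2)\<close> or \<open>(\<phi> S, i + 1)\<close>,
  so the cells fall into snakes that run from column 1 to column \<open>n\<close>. Consecutive snakes differ
  by a cyclic rotation of their step sequences: dropping the first cell and shifting the rest two
  rows down gives all but the last cell of the next snake, and the last step of the latter is the
  dropped one. Let \<open>z\<close> be a cell of column \<open>j\<close>, lying \<open>b\<close> steps after the beginning and \<open>f\<close> steps
  before the end of its snake. Going to the end of the snake and then shifting \<open>b\<close> times leads to a
  cell of column \<open>n + 1 - j\<close>, which lies \<open>f\<close> steps after the beginning and \<open>b\<close> steps before the end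
  of its own snake. Hence this map is injective, and columns \<open>j\<close> and \<open>n + 1 - j\<close> contain equally
  many cells of each orbit.
\<close>

section \<open>Toggles and \<open>phi\<close> permute the independent sets\<close>

lemma finite_indep_sets: "finite (indep_sets n)"
  by (rule finite_subset[of _ "Pow {1..n}"]) (auto simp: indep_sets_def)

lemma toggle_in_indep_sets: "S \<in> indep_sets n \<Longrightarrow> toggle n i S \<in> indep_sets n"
  by (auto simp: toggle_def indep_sets_def)

lemma toggle_toggle: "S \<in> indep_sets n \<Longrightarrow> toggle n i (toggle n i S) = S"
  by (auto simp: toggle_def insert_absorb)

lemma bij_betw_toggle: "bij_betw (toggle n i) (indep_sets n) (indep_sets n)"
  by (rule bij_betwI[where g = "toggle n i"]) (auto simp: toggle_in_indep_sets toggle_toggle)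

lemma bij_betw_fold_toggle: "bij_betw (fold (toggle n) is) (indep_sets n) (indep_sets n)"
proof (induction "is")
  case (Cons i "is")
  then show ?case using bij_betw_trans[OF bij_betw_toggle] by (simp add: comp_def)
qed (simp add: bij_betw_def)

lemma bij_betw_phi: "bij_betw (phi n) (indep_sets n) (indep_sets n)"
  unfolding phi_def by (rule bij_betw_fold_toggle)

section \<open>The local rule for membership in \<open>phi n S\<close>\<close>

lemma mem_toggle_same:
  assumes "S \<in> indep_sets n" "1 \<le> i" "i \<le> n"
  shows "i \<in> toggle n i S \<longleftrightarrow> i \<notin> S \<and> Suc i \<notin> S \<and> i - 1 \<notin> S"
proof -
  have "S \<union> {i} \<in> indep_sets n \<longleftrightarrow> Suc i \<notin> S \<and> i - 1 \<notin> S" if "i \<notin> S"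
  proof -
    have "Suc k \<noteq> i" if "k \<in> S" "i - 1 \<notin> S" for k
      using that by auto
    moreover have "Suc (i - 1) = i" using assms by simp
    ultimately show ?thesis
      using assms that unfolding indep_sets_def by (auto; metis)
  qed
  then show ?thesis by (auto simp: toggle_def)
qed

lemma mem_toggle_other: "k \<noteq> i \<Longrightarrow> k \<in> toggle n i S \<longleftrightarrow> k \<in> S"
  by (auto simp: toggle_def)

text \<open>When site i is toggled, site i - 1 already has its new state and site i + 1 still has
  its old one; later toggles leave i alone.\<close>

lemma mem_fold_toggle:
  assumes "S \<in> indep_sets n" "m \<le> n"
  defines "T \<equiv> fold (toggle n) [1..<Suc m] S"
  shows "T \<in> indep_sets n
    \<and> (\<forall>i>m. i \<in> T \<longleftrightarrow> i \<in> S)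
    \<and> (\<forall>i. 1 \<le> i \<and> i \<le> m \<longrightarrow> (i \<in> T \<longleftrightarrow> i \<notin> S \<and> Suc i \<notin> S \<and> i - 1 \<notin> T))"
  using assms(2) unfolding T_def
proof (induction m)
  case 0
  then show ?case using assms(1) by simp
next
  case (Suc m)
  let ?T = "fold (toggle n) [1..<Suc m] S"
  have IH: "?T \<in> indep_sets n" "\<And>i. i > m \<Longrightarrow> i \<in> ?T \<longleftrightarrow> i \<in> S"
    "\<And>i. 1 \<le> i \<Longrightarrow> i \<le> m \<Longrightarrow> i \<in> ?T \<longleftrightarrow> i \<notin> S \<and> Suc i \<notin> S \<and> i - 1 \<notin> ?T"
    using Suc by auto
  have eq: "fold (toggle n) [1..<Suc (Suc m)] S = toggle n (Suc m) ?T"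
    by simp
  have new: "Suc m \<in> toggle n (Suc m) ?T \<longleftrightarrow> Suc m \<notin> S \<and> Suc (Suc m) \<notin> S \<and> m \<notin> ?T"
    using mem_toggle_same[OF IH(1), of "Suc m"] IH(2)[of "Suc m"] IH(2)[of "Suc (Suc m)"] Suc.prems
    by simp
  have "i \<in> toggle n (Suc m) ?T \<longleftrightarrow> i \<notin> S \<and> Suc i \<notin> S \<and> i - 1 \<notin> toggle n (Suc m) ?T"
    if "1 \<le> i" "i \<le> Suc m" for i
  proof (cases "i = Suc m")
    case True
    then show ?thesis using new by (simp add: mem_toggle_other)
  next
    case False
    then show ?thesis using IH(3)[of i] that mem_toggle_other[of i] mem_toggle_other[of "i - 1"]
      by auto
  qed
  moreover have "i \<in> toggle n (Suc m) ?T \<longleftrightarrow> i \<in> S" if "i > Suc m" for i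
    using IH(2)[of i] that by (simp add: mem_toggle_other)
  ultimately show ?case
    using toggle_in_indep_sets[OF IH(1)] unfolding eq by blast
qed

text \<open>Apart from bijectivity and closure, this local rule is all that the snake argument uses
  about \<open>phi\<close>. At i = 1 the left neighbour is 0, which is never a member.\<close>

lemma mem_phi:
  assumes "S \<in> indep_sets n" "1 \<le> i" "i \<le> n"
  shows "i \<in> phi n S \<longleftrightarrow> i \<notin> S \<and> Suc i \<notin> S \<and> i - 1 \<notin> phi n S"
  using mem_fold_toggle[OF assms(1) order.refl] assms unfolding phi_def by blast

section \<open>Moves on the board and distances to the ends of a snake\<close>

text \<open>\<open>snake_step\<close> is meaningful only on cells left of column \<open>n\<close>, \<open>snake_shift\<close> only on cells right
  of column 1.\<close>

definition snake_step :: "nat \<Rightarrow> nat set \<times> nat \<Rightarrow> nat set \<times> nat" where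
  "snake_step n = (\<lambda>(S, i). if i + 2 \<in> S then (S, i + 2) else (phi n S, i + 1))"

definition snake_shift :: "nat \<Rightarrow> nat set \<times> nat \<Rightarrow> nat set \<times> nat" where
  "snake_shift n = (\<lambda>(S, i). let T = phi n (phi n S) in if i - 1 \<in> T then (T, i - 1) else (T, i - 2))"

lemma snd_snake_step_gt: "snd z < snd (snake_step n z)"
  by (auto simp: snake_step_def split: prod.splits)

lemma snd_snake_shift: "snd (snake_shift n z) = snd z - 1 \<or> snd (snake_shift n z) = snd z - 2"
  by (auto simp: snake_shift_def Let_def split: prod.splits)

lemma snd_snake_shift_less: "1 < snd z \<Longrightarrow> snd (snake_shift n z) < snd z"
  by (auto simp: snake_shift_def Let_def split: prod.splits)

function steps_right :: "nat \<Rightarrow> nat set \<times> nat \<Rightarrow> nat" where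
  "steps_right n z = (if snd z < n then Suc (steps_right n (snake_step n z)) else 0)"
  by pat_completeness auto
termination
  by (relation "measure (\<lambda>(n, z). n - snd z)") (auto intro: diff_less_mono2 snd_snake_step_gt)

text \<open>The distance from the beginning of the snake is measured by counting shifts down to
  column 1 instead of inverting \<open>snake_step\<close>; \<open>steps_left_step\<close> shows that
  each step raises it by one.\<close>

function steps_left :: "nat \<Rightarrow> nat set \<times> nat \<Rightarrow> nat" where
  "steps_left n z = (if 1 < snd z then Suc (steps_left n (snake_shift n z)) else 0)"
  by pat_completeness auto
termination
  by (relation "measure (\<lambda>(n, z). snd z)") (auto intro: snd_snake_shift_less)

declare steps_right.simps [simp del] steps_left.simps [simp del]

lemma steps_right_Suc: "snd z < n \<Longrightarrow> steps_right n z = Suc (steps_right n (snake_step n z))"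
  by (simp add: steps_right.simps)

lemma steps_left_Suc: "1 < snd z \<Longrightarrow> steps_left n z = Suc (steps_left n (snake_shift n z))"
  by (simp add: steps_left.simps)

lemma steps_right_pos_iff: "0 < steps_right n z \<longleftrightarrow> snd z < n"
  by (subst steps_right.simps) simp

lemma steps_left_pos_iff: "0 < steps_left n z \<longleftrightarrow> 1 < snd z"
  by (subst steps_left.simps) simp

text \<open>To be instantiated with a single orbit. Both moves only go forward along
  \<open>phi\<close>, so closure under \<open>phi\<close> keeps them inside
  \<open>X\<close>.\<close>

locale phi_invariant =
  fixes n :: nat and X :: "nat set set"
  assumes subset_indep_sets: "X \<subseteq> indep_sets n"
    and phi_closed: "S \<in> X \<Longrightarrow> phi n S \<in> X"
begin

definition cells :: "(nat set \<times> nat) set" where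
  "cells = {(S, i). S \<in> X \<and> i \<in> S}"

section \<open>Steps and shifts are well defined and injective on cells\<close>

lemma mem_bounds: "S \<in> X \<Longrightarrow> i \<in> S \<Longrightarrow> 1 \<le> i \<and> i \<le> n"
  using subset_indep_sets by (fastforce simp: indep_sets_def)

lemma not_adjacent: "S \<in> X \<Longrightarrow> i \<in> S \<Longrightarrow> Suc i \<notin> S"
  using subset_indep_sets by (auto simp: indep_sets_def)

lemma Suc_mem_phi:
  "S \<in> X \<Longrightarrow> i < n \<Longrightarrow> Suc i \<in> phi n S \<longleftrightarrow> Suc i \<notin> S \<and> Suc (Suc i) \<notin> S \<and> i \<notin> phi n S"
  using mem_phi[of S n "Suc i"] subset_indep_sets by auto

lemma snd_cell_bounds: "z \<in> cells \<Longrightarrow> 1 \<le> snd z \<and> snd z \<le> n"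
  by (auto simp: cells_def dest: mem_bounds)

lemma mem_phi_imp: "S \<in> X \<Longrightarrow> i \<in> phi n S \<Longrightarrow> i \<notin> S \<and> Suc i \<notin> S"
  using mem_phi[of S n i] mem_bounds[OF phi_closed, of S i] subset_indep_sets by blast

text \<open>As i is in S, neither i + 1 in S nor i in \<open>phi n S\<close> can occur, so one
  condition of the local rule survives. Hence exactly one candidate for the successor of (S, i) is a
  cell.\<close>

lemma Suc_mem_phi_if_mem:
  assumes "S \<in> X" "i \<in> S" "i < n"
  shows "Suc i \<in> phi n S \<longleftrightarrow> Suc (Suc i) \<notin> S"
  using Suc_mem_phi[OF assms(1,3)] assms mem_phi_imp[OF assms(1), of i] not_adjacent by blast

text \<open>The element i + 2 of S keeps i + 1 and i + 2 out of \<open>phi n S\<close>, which leaves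
  one condition for i + 1 in the next row. Hence exactly one candidate for the shift of (S, i + 2)
  is a cell.\<close>

lemma mem_phi_phi:
  assumes "S \<in> X" "Suc (Suc i) \<in> S"
  shows "Suc i \<in> phi n (phi n S) \<longleftrightarrow> i \<notin> phi n (phi n S)"
proof -
  have "i < n" using mem_bounds[OF assms] by simp
  then show ?thesis
    using Suc_mem_phi[OF phi_closed[OF assms(1)], of i] mem_phi_imp[OF assms(1)] assms(2) by blast
qed

lemma snake_step_in_cells: "z \<in> cells \<Longrightarrow> snd z < n \<Longrightarrow> snake_step n z \<in> cells"
  using Suc_mem_phi_if_mem by (auto simp: cells_def snake_step_def phi_closed split: if_splits)

lemma snake_shift_in_cells:
  assumes "z \<in> cells" "1 < snd z"
  shows "snake_shift n z \<in> cells"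
proof -
  obtain S i where z: "z = (S, Suc (Suc i))"
    using assms(2) by (cases z) (auto dest!: less_imp_Suc_add)
  then have "S \<in> X" "Suc (Suc i) \<in> S" using assms(1) by (auto simp: cells_def)
  then show ?thesis
    using mem_phi_phi[of S i] by (auto simp: z cells_def snake_shift_def Let_def phi_closed)
qed

lemma inj_on_phi: "inj_on (phi n) X"
  using bij_betw_phi[of n] subset_indep_sets by (auto simp: bij_betw_def intro: inj_on_subset)

lemma phi_eq_iff: "S \<in> X \<Longrightarrow> T \<in> X \<Longrightarrow> phi n S = phi n T \<longleftrightarrow> S = T"
  using inj_on_phi by (auto dest: inj_onD)

text \<open>Steps of different width cannot meet: S = \<open>phi n T\<close> and k = i + 1 would put
  i into \<open>phi n T\<close> although i + 1 is in T.\<close>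

lemma inj_on_snake_step: "inj_on (snake_step n) (cells \<inter> {z. snd z < n})"
proof (rule inj_onI, clarify)
  fix S T :: "nat set" and i k :: nat
  assume "(S, i) \<in> cells" "(T, k) \<in> cells" and eq: "snake_step n (S, i) = snake_step n (T, k)"
  then have ST: "S \<in> X" "i \<in> S" "T \<in> X" "k \<in> T" by (auto simp: cells_def)
  then show "S = T \<and> i = k"
    using eq phi_eq_iff[of S T] mem_phi_imp[of S k] mem_phi_imp[of T i]
    by (auto simp: snake_step_def split: if_splits)
qed

text \<open>Equal rows come from injectivity of \<open>phi\<close>; the columns then differ by at
  most 1, and an independent set has no adjacent elements.\<close>

lemma inj_on_snake_shift: "inj_on (snake_shift n) (cells \<inter> {z. 1 < snd z})"
proof (rule inj_onI, clarify)
  fix S T :: "nat set" and i k :: nat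
  assume "(S, i) \<in> cells" "(T, k) \<in> cells" "1 < snd (S, i)" "1 < snd (T, k)"
    and eq: "snake_shift n (S, i) = snake_shift n (T, k)"
  then have ST: "S \<in> X" "i \<in> S" "T \<in> X" "k \<in> T" "1 < i" "1 < k" by (auto simp: cells_def)
  have "phi n (phi n S) = phi n (phi n T)"
    using eq by (auto simp: snake_shift_def Let_def split: if_splits)
  then have "S = T" using ST by (simp add: phi_eq_iff phi_closed)
  moreover have "i = k \<or> i = Suc k \<or> k = Suc i"
    using snd_snake_shift[of n "(S, i)"] snd_snake_shift[of n "(T, k)"] ST(5,6) unfolding eq
    by simp linarith
  ultimately show "S = T \<and> i = k" using ST not_adjacent[of S i] not_adjacent[of S k] by auto
qed

section \<open>Steps commute with shifts\<close>

lemma snake_shift_step: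
  assumes "z \<in> cells" "1 < snd z" "snd z < n"
  shows "snake_shift n (snake_step n z) = snake_step n (snake_shift n z)"
    and "snd (snake_shift n (snake_step n z)) + snd z = snd (snake_step n z) + snd (snake_shift n z)"
proof -
  obtain S i where z: "z = (S, Suc (Suc i))"
    using assms(2) by (cases z) (auto dest!: less_imp_Suc_add)
  define S1 S2 S3 where "S1 = phi n S" and "S2 = phi n S1" and "S3 = phi n S2"
  have X: "S \<in> X" "S1 \<in> X" "S2 \<in> X" "S3 \<in> X" and S: "Suc (Suc i) \<in> S" and i: "Suc (Suc i) < n"
    using assms z by (auto simp: cells_def S1_def S2_def S3_def phi_closed)
  have 1: "Suc (Suc (Suc i)) \<in> S1 \<longleftrightarrow> Suc (Suc (Suc (Suc i))) \<notin> S"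
    using Suc_mem_phi_if_mem[OF X(1) S i] by (simp add: S1_def)
  have 2: "Suc i \<in> S2 \<longleftrightarrow> i \<notin> S2"
    using mem_phi_phi[OF X(1) S] by (simp add: S1_def S2_def)
  \<comment> \<open>The second conjunct says that a step and its shifted copy have equal width;
    writing it with sums avoids truncated subtraction.\<close>
  have "snake_shift n (snake_step n z) = snake_step n (snake_shift n z) \<and>
     snd (snake_shift n (snake_step n z)) + snd z = snd (snake_step n z) + snd (snake_shift n z)"
  proof (cases "Suc (Suc (Suc (Suc i))) \<in> S")
    case True
    \<comment> \<open>Step of width two: \<open>S1\<close> misses columns i + 2 to i + 4, so
      membership in \<open>S2\<close> alternates over columns i to i + 3 and both ends of the step
      shift equally far.\<close>
    have "Suc (Suc i) \<notin> S1" "Suc (Suc (Suc i)) \<notin> S1" "Suc (Suc (Suc (Suc i))) \<notin> S1"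
      using mem_phi_imp[OF X(1)] True S by (auto simp: S1_def)
    then have "Suc (Suc i) \<in> S2 \<longleftrightarrow> Suc i \<notin> S2" "Suc (Suc (Suc i)) \<in> S2 \<longleftrightarrow> Suc (Suc i) \<notin> S2"
      using Suc_mem_phi[OF X(2)] i by (simp_all add: S2_def)
    then show ?thesis
      using True 2 by (simp add: z snake_step_def snake_shift_def Let_def S1_def[symmetric] S2_def[symmetric])
  next
    case False
    \<comment> \<open>Step of width one: column i + 3 of \<open>S1\<close> keeps i + 2 and i + 3 out
      of \<open>S2\<close>, so the shifted cell also moves down to the next row,
      \<open>S3\<close>.\<close>
    with 1 have "Suc (Suc i) \<notin> S2" "Suc (Suc (Suc i)) \<notin> S2"
      using mem_phi_imp[OF X(2)] by (auto simp: S2_def)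
    then have "Suc i \<in> S2 \<Longrightarrow> Suc (Suc i) \<in> S3" "i \<in> S2 \<Longrightarrow> Suc i \<in> S3"
      using Suc_mem_phi_if_mem[OF X(3)] i by (simp_all add: S3_def)
    then have "Suc (Suc i) \<in> S3 \<longleftrightarrow> Suc i \<in> S2"
      using not_adjacent[OF X(4), of "Suc i"] 2 by blast
    then show ?thesis
      using False 2 \<open>Suc (Suc i) \<notin> S2\<close> \<open>Suc (Suc (Suc i)) \<notin> S2\<close>
      by (auto simp: z snake_step_def snake_shift_def Let_def S1_def[symmetric] S2_def[symmetric]
          S3_def[symmetric])
  qed
  then show "snake_shift n (snake_step n z) = snake_step n (snake_shift n z)"
    "snd (snake_shift n (snake_step n z)) + snd z = snd (snake_step n z) + snd (snake_shift n z)"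
    by auto
qed

text \<open>The second cell of a snake shifts to the beginning of the next snake, because column 0
  is empty. This is the base case of \<open>steps_left_step\<close>.\<close>

lemma snd_snake_shift_step_first:
  assumes "z \<in> cells" "snd z = 1" "1 < n"
  shows "snd (snake_shift n (snake_step n z)) = 1"
proof -
  obtain S where z: "z = (S, 1)" using assms(2) by (cases z) simp
  then have X: "S \<in> X" "phi n S \<in> X" "phi n (phi n S) \<in> X" and S: "1 \<in> S"
    using assms(1) by (auto simp: cells_def phi_closed)
  have "0 \<notin> T" if "T \<in> X" for T using mem_bounds[OF that] by fastforce
  note 0 = this[OF X(3)] this[OF phi_closed[OF X(3)]]
  show ?thesis
  proof (cases "3 \<in> S")
    case True
    then have "Suc 0 \<notin> phi n S" "Suc (Suc 0) \<notin> phi n S"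
      using mem_phi_imp[OF X(1)] S by (auto simp: numeral_3_eq_3)
    then have "Suc 0 \<in> phi n (phi n S)"
      using Suc_mem_phi[OF X(2), of 0] assms(3) 0 by simp
    then show ?thesis
      using True not_adjacent[OF X(3), of "Suc 0"]
      by (simp add: z snake_step_def snake_shift_def Let_def numeral_2_eq_2 numeral_3_eq_3)
  next
    case False
    then have "Suc (Suc 0) \<in> phi n S"
      using Suc_mem_phi_if_mem[OF X(1) S] assms(3) by (simp add: numeral_3_eq_3)
    then have "Suc 0 \<in> phi n (phi n (phi n S))"
      using mem_phi_phi[OF X(2)] 0 by simp
    then show ?thesis
      using False by (simp add: z snake_step_def snake_shift_def Let_def numeral_3_eq_3)
  qed
qed

text \<open>The last cell shifts to the last but one of the next snake, because column n + 1 is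
  empty. This is the base case of \<open>steps_right_shift\<close>.\<close>

lemma snd_snake_step_shift_last:
  assumes "z \<in> cells" "snd z = n" "1 < n"
  shows "snd (snake_step n (snake_shift n z)) = n"
proof -
  obtain S i where z: "z = (S, Suc (Suc i))" and n: "n = Suc (Suc i)"
    using assms(2,3) by (cases z) (auto dest!: less_imp_Suc_add)
  have X: "S \<in> X" "phi n S \<in> X" "phi n (phi n S) \<in> X" and S: "Suc (Suc i) \<in> S"
    using assms(1) z by (auto simp: cells_def phi_closed)
  have Suc_n: "Suc (Suc (Suc i)) \<notin> T" if "T \<in> X" for T
    using mem_bounds[OF that] n by fastforce
  have "Suc (Suc i) \<notin> phi n S"
    using mem_phi_imp[OF X(1)] S by blast
  then have "Suc (Suc i) \<in> phi n (phi n S) \<longleftrightarrow> Suc i \<notin> phi n (phi n S)"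
    using Suc_mem_phi[OF X(2), of "Suc i"] Suc_n[OF X(2)] n by simp
  then show ?thesis
    using Suc_n[OF X(3)] by (simp add: z snake_step_def snake_shift_def Let_def) (simp add: n)
qed

text \<open>Induction on the column: by commutation, shifting z and its successor gives again a cell
  and its successor, further left.\<close>

lemma steps_left_step:
  "z \<in> cells \<Longrightarrow> snd z < n \<Longrightarrow> steps_left n (snake_step n z) = Suc (steps_left n z)"
proof (induction "snd z" arbitrary: z rule: less_induct)
  case less
  have gt: "1 < snd (snake_step n z)"
    using snd_snake_step_gt[of z n] snd_cell_bounds[OF less.prems(1)] by simp
  show ?case
  proof (cases "snd z = 1")
    case True
    then show ?thesis
      using steps_left_Suc[OF gt] snd_snake_shift_step_first less.prems by (simp add: steps_left.simps)
  next
    case False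
    then have "1 < snd z" using snd_cell_bounds[OF less.prems(1)] by simp
    then show ?thesis
      using less.hyps[of "snake_shift n z"] snake_shift_step(1)[of z] snd_snake_shift_less[of z n]
        snake_shift_in_cells steps_left_Suc gt less.prems by simp
  qed
qed

text \<open>Dual induction towards column n, stepping where \<open>steps_left_step\<close>
  shifts.\<close>

lemma steps_right_shift:
  "z \<in> cells \<Longrightarrow> 1 < snd z \<Longrightarrow> steps_right n (snake_shift n z) = Suc (steps_right n z)"
proof (induction "n - snd z" arbitrary: z rule: less_induct)
  case less
  have lt: "snd (snake_shift n z) < n"
    using snd_snake_shift_less[of z n] snd_cell_bounds less.prems by fastforce
  show ?case
  proof (cases "snd z = n")
    case True
    then show ?thesis
      using steps_right_Suc[OF lt] snd_snake_step_shift_last less.prems by (simp add: steps_right.simps)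
  next
    case False
    then have "snd z < n" using snd_cell_bounds[OF less.prems(1)] by simp
    then show ?thesis
      using less.hyps[of "snake_step n z"] snake_shift_step(1)[of z] snd_snake_step_gt[of z n]
        snake_step_in_cells steps_right_Suc lt less.prems by (simp add: diff_less_mono2)
  qed
qed

text \<open>In the coordinates (b, f) = (\<open>steps_left\<close>, \<open>steps_right\<close>) a
  step is (b + 1, f - 1) and a shift is (b - 1, f + 1); the sum b + f never changes.\<close>

lemma funpow_snake_step:
  assumes "z \<in> cells" "l \<le> steps_right n z"
  shows "(snake_step n ^^ l) z \<in> cells \<and>
    steps_right n ((snake_step n ^^ l) z) = steps_right n z - l \<and>
    steps_left n ((snake_step n ^^ l) z) = steps_left n z + l"
  using assms(2)
proof (induction l)
  case (Suc l)
  let ?y = "(snake_step n ^^ l) z"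
  have y: "?y \<in> cells" "steps_right n ?y = steps_right n z - l" "steps_left n ?y = steps_left n z + l"
    using Suc by simp_all
  then have "snd ?y < n" using Suc.prems steps_right_pos_iff[of n ?y] by simp
  then show ?case using y steps_right_Suc[of ?y] by (simp add: snake_step_in_cells steps_left_step)
qed (use assms in simp)

lemma funpow_snake_shift:
  assumes "z \<in> cells" "k \<le> steps_left n z"
  shows "(snake_shift n ^^ k) z \<in> cells \<and>
    steps_left n ((snake_shift n ^^ k) z) = steps_left n z - k \<and>
    steps_right n ((snake_shift n ^^ k) z) = steps_right n z + k"
  using assms(2)
proof (induction k)
  case (Suc k)
  let ?y = "(snake_shift n ^^ k) z"
  have y: "?y \<in> cells" "steps_left n ?y = steps_left n z - k" "steps_right n ?y = steps_right n z + k"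
    using Suc by simp_all
  then have "1 < snd ?y" using Suc.prems steps_left_pos_iff[of n ?y] by simp
  then show ?case using y steps_left_Suc[of ?y n] by (simp add: snake_shift_in_cells steps_right_shift)
qed (use assms in simp)

lemma snake_shift_funpow_step:
  assumes "z \<in> cells" "1 < snd z" "l \<le> steps_right n z"
  shows "snake_shift n ((snake_step n ^^ l) z) = (snake_step n ^^ l) (snake_shift n z) \<and>
    snd ((snake_step n ^^ l) (snake_shift n z)) + snd z
      = snd ((snake_step n ^^ l) z) + snd (snake_shift n z)"
  using assms(3)
proof (induction l)
  case (Suc l)
  let ?y = "(snake_step n ^^ l) z"
  have y: "?y \<in> cells" "steps_right n ?y = steps_right n z - l" "steps_left n ?y = steps_left n z + l"
    using funpow_snake_step[OF assms(1)] Suc.prems by simp_all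
  then have "snd ?y < n" "1 < snd ?y"
    using Suc.prems assms(2) steps_right_pos_iff[of n ?y] steps_left_pos_iff[of n ?y]
      steps_left_pos_iff[of n z] by simp_all
  then show ?case using snake_shift_step[of ?y] y(1) Suc by simp
qed simp

text \<open>Parallelogram law for columns: k strips from \<open>snake_shift_funpow_step\<close> are
  stacked, each preserving the displacement of the l steps.\<close>

lemma snd_funpow_shift_step:
  assumes "z \<in> cells" "l \<le> steps_right n z" "k \<le> steps_left n z"
  shows "snd ((snake_shift n ^^ k) ((snake_step n ^^ l) z)) + snd z
    = snd ((snake_step n ^^ l) z) + snd ((snake_shift n ^^ k) z)"
  using assms
proof (induction k arbitrary: z)
  case (Suc k)
  let ?y = "snake_shift n z"
  have "1 < snd z" using Suc.prems steps_left_pos_iff[of n z] by simp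
  then have "?y \<in> cells" "l \<le> steps_right n ?y" "k \<le> steps_left n ?y"
    using Suc.prems steps_left_Suc[of z n] by (simp_all add: snake_shift_in_cells steps_right_shift)
  from Suc.IH[OF this] show ?case
    using snake_shift_funpow_step[OF Suc.prems(1) \<open>1 < snd z\<close> Suc.prems(2)]
    by (simp add: funpow_Suc_right del: funpow.simps)
qed simp

section \<open>The mirror map between columns j and n + 1 - j\<close>

definition mirror :: "nat set \<times> nat \<Rightarrow> nat set \<times> nat" where
  "mirror z = (snake_shift n ^^ steps_left n z) ((snake_step n ^^ steps_right n z) z)"

text \<open>The coordinates go from (b, f) to (b + f, 0) by f steps and on to (f, b) by b
  shifts.\<close>

lemma mirror_in_cells:
  assumes "z \<in> cells"
  shows "mirror z \<in> cells" "steps_left n (mirror z) = steps_right n z"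
    "steps_right n (mirror z) = steps_left n z"
  using funpow_snake_step[OF assms order.refl]
    funpow_snake_shift[of "(snake_step n ^^ steps_right n z) z" "steps_left n z"]
  by (simp_all add: mirror_def)

text \<open>In the parallelogram spanned by f steps and b shifts the two corners next to z lie in
  columns n and 1, so the columns of z and \<open>mirror z\<close> add up to n + 1.\<close>

lemma snd_mirror:
  assumes "z \<in> cells"
  shows "snd (mirror z) = n + 1 - snd z"
proof -
  let ?e = "(snake_step n ^^ steps_right n z) z" and ?b = "(snake_shift n ^^ steps_left n z) z"
  have "snd ?e = n"
    using funpow_snake_step[OF assms order.refl] steps_right_pos_iff[of n ?e] snd_cell_bounds[of ?e]
    by simp
  moreover have "snd ?b = 1"
    using funpow_snake_shift[OF assms order.refl] steps_left_pos_iff[of n ?b] snd_cell_bounds[of ?b]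
    by simp
  ultimately show ?thesis
    using snd_funpow_shift_step[OF assms order.refl order.refl] by (simp add: mirror_def)
qed

text \<open>The bound on l keeps every cell that is left by a step strictly left of column n, where
  \<open>snake_step\<close> is injective.\<close>

lemma funpow_snake_step_eqD:
  assumes "z \<in> cells" "z' \<in> cells" "l \<le> steps_right n z" "l \<le> steps_right n z'"
    and "(snake_step n ^^ l) z = (snake_step n ^^ l) z'"
  shows "z = z'"
  using assms
proof (induction l arbitrary: z z')
  case (Suc l)
  then have lt: "snd z < n" "snd z' < n"
    using steps_right_pos_iff[of n] by (metis Suc_le_lessD less_nat_zero_code neq0_conv)+
  then have "snake_step n z = snake_step n z'"
    using Suc.IH[of "snake_step n z" "snake_step n z'"] Suc.prems steps_right_Suc[of z] steps_right_Suc[of z']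
    by (simp add: snake_step_in_cells funpow_Suc_right del: funpow.simps)
  then show ?case using inj_on_snake_step lt Suc.prems by (auto dest: inj_onD)
qed simp

lemma funpow_snake_shift_eqD:
  assumes "z \<in> cells" "z' \<in> cells" "k \<le> steps_left n z" "k \<le> steps_left n z'"
    and "(snake_shift n ^^ k) z = (snake_shift n ^^ k) z'"
  shows "z = z'"
  using assms
proof (induction k arbitrary: z z')
  case (Suc k)
  then have lt: "1 < snd z" "1 < snd z'"
    using steps_left_pos_iff[of n] by (metis Suc_le_lessD less_nat_zero_code neq0_conv)+
  then have "snake_shift n z = snake_shift n z'"
    using Suc.IH[of "snake_shift n z" "snake_shift n z'"] Suc.prems steps_left_Suc[of z] steps_left_Suc[of z']
    by (simp add: snake_shift_in_cells funpow_Suc_right del: funpow.simps)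
  then show ?case using inj_on_snake_shift lt Suc.prems by (auto dest: inj_onD)
qed simp

lemma inj_on_mirror: "inj_on mirror cells"
proof (rule inj_onI)
  fix z z' assume z: "z \<in> cells" "z' \<in> cells" and eq: "mirror z = mirror z'"
  \<comment> \<open>\<open>mirror\<close> swaps the two distances, so the image determines how many
    shifts and steps have to be undone.\<close>
  have steps: "steps_right n z = steps_right n z'" "steps_left n z = steps_left n z'"
    using mirror_in_cells z eq by metis+
  let ?e = "\<lambda>z. (snake_step n ^^ steps_right n z) z"
  have "?e z = ?e z'"
    using funpow_snake_shift_eqD[of "?e z" "?e z'" "steps_left n z"] eq steps
      funpow_snake_step[OF z(1) order.refl] funpow_snake_step[OF z(2) order.refl]
    by (simp add: mirror_def)
  then show "z = z'"
    using funpow_snake_step_eqD[OF z, of "steps_right n z"] steps by simp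
qed

section \<open>Counting columns within an orbit\<close>

lemma card_column_le:
  assumes "finite X"
  shows "card {S \<in> X. j \<in> S} \<le> card {S \<in> X. n + 1 - j \<in> S}"
proof (rule card_inj_on_le)
  \<comment> \<open>The column of the mirrored cell is known to be n + 1 - j, so its row alone
    determines it.\<close>
  let ?g = "\<lambda>S. fst (mirror (S, j))"
  have mirror: "mirror (S, j) = (?g S, n + 1 - j)" "mirror (S, j) \<in> cells"
    if "S \<in> X" "j \<in> S" for S
    using snd_mirror[of "(S, j)"] mirror_in_cells(1)[of "(S, j)"] that
    by (auto simp: cells_def prod_eq_iff)
  show "inj_on ?g {S \<in> X. j \<in> S}"
  proof (rule inj_onI)
    fix S T assume "S \<in> {S \<in> X. j \<in> S}" "T \<in> {S \<in> X. j \<in> S}" "?g S = ?g T"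
    then show "S = T"
      using mirror(1)[of S] mirror(1)[of T] inj_onD[OF inj_on_mirror, of "(S, j)" "(T, j)"]
      by (simp add: cells_def)
  qed
  show "?g ` {S \<in> X. j \<in> S} \<subseteq> {S \<in> X. n + 1 - j \<in> S}"
    using mirror by (fastforce simp: cells_def)
qed (use assms in simp)

end

theorem theorem2p9:
  fixes n j :: nat
  assumes "n \<ge> 2" and "1 \<le> j" and "j \<le> n"
  shows "mesic (0 :: 'k::field_char_0) (\<lambda>S. chi j S - chi (n + 1 - j) S) (phi n) (indep_sets n)"
proof -
  have "(\<Sum>S\<in>orbit (phi n) S\<^sub>0. chi j S - chi (n + 1 - j) S) = (0 :: 'k)"
    if "S\<^sub>0 \<in> indep_sets n" for S\<^sub>0
  proof -
    let ?O = "orbit (phi n) S\<^sub>0"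
    have "S \<in> indep_sets n" if "S \<in> ?O" for S
      using that \<open>S\<^sub>0 \<in> indep_sets n\<close> bij_betw_apply[OF bij_betw_phi] by induction auto
    then interpret phi_invariant n ?O
      by unfold_locales (auto intro: orbit.step)
    have fin: "finite ?O"
      using subset_indep_sets finite_indep_sets finite_subset by blast
    \<comment> \<open>Reflecting twice returns to j, so the inequality holds in both
      directions.\<close>
    have "n + 1 - (n + 1 - j) = j" using assms by simp
    then have "card {S \<in> ?O. j \<in> S} = card {S \<in> ?O. n + 1 - j \<in> S}"
      using card_column_le[OF fin, of j] card_column_le[OF fin, of "n + 1 - j"] by simp
    moreover have "(\<Sum>S\<in>?O. chi i S :: 'k) = of_nat (card {S \<in> ?O. i \<in> S})" for i
      using fin by (simp add: chi_def sum.If_cases Int_def)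
    ultimately show ?thesis by (simp add: sum_subtractf)
  qed
  then show ?thesis
    by (simp add: mesic_def finite_indep_sets bij_betw_phi)
qed

end
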